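(* Let $n\geq3$. The monoid $\mathcal{DPC}_n$ is defined by the presentation $\langle B\mid Q\rangle$ on $3$ generators, where $B=\{g,h,e\}$ and $Q$ is the set of the following monoid relations: $(Q_1)$ $g^n=1$, $h^2=1$ and $hg=g^{n-1}h$; $(Q_2)$ $e^2=e$ and $ghegh=e$; $(Q_3)$ $eg^{j-i}eg^{n-j+i}=g^{j-i}eg^{n-j+i}e$, for $1\leq i<j\leq n$; $(Q_4)$ $hg(eg)^{n-2}e=(eg)^{n-2}e$, if $n$ is odd; $(Q_5)$ $hg(eg)^{\frac n2-1}g(eg)^{\frac n2-2}e=(eg)^{\frac n2-1}g(eg)^{\frac n2-2}e$ and $h(eg)^{n-1}e=(eg)^{n-1}e$, if $n$ is even.
   Context: A monoid $M$ is defined by a presentation $\langle B\mid Q\rangle$, where $B$ is an alphabet and $Q\subseteq B^*\times B^*$ is a set of relations of the free monoid $B^*$ (a pair $(u,v)$ being written $u=v$), if $M\cong B^*/\rho_Q$, where $\rho_Q$ is the smallest congruence on $B^*$ containing $Q$. For $n\geq3$, $C_n$ is the cycle graph with vertex set $\{1,\ldots,n\}$ and edges $\{i,i+1\}$ ($1\leq i\leq n-1$) and $\{1,n\}$; $\mathrm{d}(x,y)=\min\{|x-y|,n-|x-y|\}$ is the geodesic distance in $C_n$. $\mathcal{DPC}_n$ is the monoid, under composition (maps written on the right and composed from left to right), of all partial isometries of $C_n$, i.e. of all partial transformations $\alpha$ of $\{1,\ldots,n\}$ (including the empty one) such that $\mathrm{d}(x\alpha,y\alpha)=\mathrm{d}(x,y)$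 for all $x,y\in\mathrm{Dom}(\alpha)$. In the presentation, the letters correspond to the following elements of $\mathcal{DPC}_n$: $g$ to the permutation with $ig=i+1$ for $i<n$ and $ng=1$; $h$ to the permutation with $ih=n+1-i$; $e$ to the identity map on $\{1,\ldots,n-1\}$. *)

theory Defs
  imports "HOL-Algebra.Group"
begin

section \<open>Monoid presentations\<close>

text \<open>The alphabet is the whole type \<open>'b\<close>, so the free monoid on it is the type
  \<open>'b list\<close> under concatenation.\<close>

definition word_congruence :: "('b list \<times> 'b list) set \<Rightarrow> bool" where
  "word_congruence \<rho> \<longleftrightarrow> equiv UNIV \<rho> \<and>
     (\<forall>(u, u') \<in> \<rho>. \<forall>(v, v') \<in> \<rho>. (u @ v, u' @ v') \<in> \<rho>)"

definition gen_congruence :: "('b list \<times> 'b list) set \<Rightarrow> ('b list \<times> 'b list) set" where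
  "gen_congruence Q = \<Inter>{\<rho>. word_congruence \<rho> \<and> Q \<subseteq> \<rho>}"

definition presented_monoid :: "('b list \<times> 'b list) set \<Rightarrow> 'b list set monoid" where
  "presented_monoid Q =
     \<lparr>carrier = UNIV // gen_congruence Q,
      mult = (\<lambda>X Y. \<Union>u\<in>X. \<Union>v\<in>Y. gen_congruence Q `` {u @ v}),
      one = gen_congruence Q `` {[]}\<rparr>"

text \<open>\<open>M\<close> is defined by the presentation with relations \<open>Q\<close>, the letter \<open>b\<close> standing for the
  element \<open>f b\<close> of \<open>M\<close>. An element of \<^const>\<open>iso\<close> is a multiplicative bijection; between
  monoids it necessarily preserves the unit.\<close>

definition defined_by_presentation ::
    "('a, 'm) monoid_scheme \<Rightarrow> ('b \<Rightarrow> 'a) \<Rightarrow> ('b list \<times> 'b list) set \<Rightarrow> bool" where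
  "defined_by_presentation M f Q \<longleftrightarrow> monoid M \<and>
     (\<exists>\<phi> \<in> iso (presented_monoid Q) M. \<forall>b. \<phi> (gen_congruence Q `` {[b]}) = f b)"


section \<open>The monoid of partial isometries of the cycle graph\<close>

text \<open>Geodesic distance in the cycle graph with vertices \<open>1, \<dots>, n\<close>. It is integer valued
  to avoid truncated subtraction.\<close>

definition cycle_dist :: "nat \<Rightarrow> nat \<Rightarrow> nat \<Rightarrow> int" where
  "cycle_dist n x y = min \<bar>int x - int y\<bar> (int n - \<bar>int x - int y\<bar>)"

definition partial_isometries :: "nat \<Rightarrow> (nat \<rightharpoonup> nat) set" where
  "partial_isometries n =
     {\<alpha>. dom \<alpha> \<subseteq> {1..n} \<and> ran \<alpha> \<subseteq> {1..n} \<and>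
         (\<forall>x \<in> dom \<alpha>. \<forall>y \<in> dom \<alpha>.
            cycle_dist n (the (\<alpha> x)) (the (\<alpha> y)) = cycle_dist n x y)}"

text \<open>Maps are composed from left to right: \<open>\<alpha> \<otimes> \<beta>\<close> applies \<open>\<alpha>\<close> first.\<close>

definition DPC :: "nat \<Rightarrow> (nat \<rightharpoonup> nat) monoid" where
  "DPC n =
     \<lparr>carrier = partial_isometries n,
      mult = (\<lambda>\<alpha> \<beta>. \<beta> \<circ>\<^sub>m \<alpha>),
      one = Some |` {1..n}\<rparr>"

datatype letter = Lg | Lh | Le

fun letter_map :: "nat \<Rightarrow> letter \<Rightarrow> (nat \<rightharpoonup> nat)" where
  "letter_map n Lg = (\<lambda>i. if i < n then Some (i + 1) else Some 1) |` {1..n}"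
| "letter_map n Lh = (\<lambda>i. Some (n + 1 - i)) |` {1..n}"
| "letter_map n Le = Some |` {1..n - 1}"


section \<open>The relations\<close>

definition wpow :: "'b list \<Rightarrow> nat \<Rightarrow> 'b list" where
  "wpow w k = concat (replicate k w)"

definition Q1 :: "nat \<Rightarrow> (letter list \<times> letter list) set" where
  "Q1 n = {(wpow [Lg] n, []),
           ([Lh, Lh], []),
           ([Lh, Lg], wpow [Lg] (n - 1) @ [Lh])}"

definition Q2 :: "(letter list \<times> letter list) set" where
  "Q2 = {([Le, Le], [Le]),
         ([Lg, Lh, Le, Lg, Lh], [Le])}"

definition Q3 :: "nat \<Rightarrow> (letter list \<times> letter list) set" where
  "Q3 n = {([Le] @ wpow [Lg] (j - i) @ [Le] @ wpow [Lg] (n - j + i),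
            wpow [Lg] (j - i) @ [Le] @ wpow [Lg] (n - j + i) @ [Le])
           | i j. 1 \<le> i \<and> i < j \<and> j \<le> n}"

definition Q4 :: "nat \<Rightarrow> (letter list \<times> letter list) set" where
  "Q4 n = (if odd n then
      {([Lh, Lg] @ wpow [Le, Lg] (n - 2) @ [Le],
        wpow [Le, Lg] (n - 2) @ [Le])}
    else {})"

definition Q5 :: "nat \<Rightarrow> (letter list \<times> letter list) set" where
  "Q5 n = (if even n then
      {([Lh, Lg] @ wpow [Le, Lg] (n div 2 - 1) @ [Lg] @ wpow [Le, Lg] (n div 2 - 2) @ [Le],
        wpow [Le, Lg] (n div 2 - 1) @ [Lg] @ wpow [Le, Lg] (n div 2 - 2) @ [Le]),
       ([Lh] @ wpow [Le, Lg] (n - 1) @ [Le],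
        wpow [Le, Lg] (n - 1) @ [Le])}
    else {})"

definition DPC_relations :: "nat \<Rightarrow> (letter list \<times> letter list) set" where
  "DPC_relations n = Q1 n \<union> Q2 \<union> Q3 n \<union> Q4 n \<union> Q5 n"

end

(*
Every partial isometry of the cycle is a restriction of a dihedral permutation, so the letters generate
DPC n. Conversely, (Q1)-(Q3) bring every word to the form D * E, with D dihedral and E a product of
commuting idempotents that delete single vertices. Two such forms act alike only if they delete
the same vertices and their dihedral parts agree on the remaining ones. Distinct dihedral permutations
agree only on fixed points of a common reflection (at most two vertices), and there (Q4) and (Q5),
conjugated by rotations, say exactly that this reflection is absorbed by E.
*)
theory Submission
  imports Defs
begin

section \<open>Presented monoids\<close>

text \<open>Congruence of words is tested by evaluation: two words are congruent once they have
  equal values in monoids satisfying the relations, so the algebra takes place in an abstract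
  monoid. The action is lifted to the integers, where every comparison is a divisibility by n. The
  relations (Q4) and (Q5) match the conjugacy classes of reflections. Conjugating i -> c - i by a
  rotation changes c by an even number, and c matters only modulo n. For n odd there is one class,
  with a single fixed vertex; for n even there are two: c even, with two antipodal fixed vertices,
  and c odd, with none. The words in (Q4) and (Q5) delete exactly the vertices moved by one
  representative of each class, with c = 2 or c = 1. Two different rotations agree nowhere; that
  case reduces to reflections, a rotation being a product of two of them.\<close>

lemma word_congruence_gen_congruence: "word_congruence (gen_congruence Q)"
proof -
  have "equiv UNIV (gen_congruence Q)"
  proof (rule equivI)
    show "refl (gen_congruence Q)"
      unfolding gen_congruence_def refl_on_def word_congruence_def equiv_def by blast
    show "sym (gen_congruence Q)"
      unfolding gen_congruence_def word_congruence_def equiv_def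
      by (rule symI) (blast dest: symD)
    show "trans (gen_congruence Q)"
      unfolding gen_congruence_def word_congruence_def equiv_def
      by (rule transI) (blast dest: transD)
  qed auto
  then show ?thesis
    unfolding word_congruence_def gen_congruence_def by blast
qed

lemmas equiv_gen_congruence =
  word_congruence_gen_congruence[unfolded word_congruence_def, THEN conjunct1]

lemma gen_congruence_append:
  "(u, u') \<in> gen_congruence Q \<Longrightarrow> (v, v') \<in> gen_congruence Q \<Longrightarrow>
   (u @ v, u' @ v') \<in> gen_congruence Q"
  using word_congruence_gen_congruence[of Q] unfolding word_congruence_def by blast

lemma gen_congruence_refl: "(u, u) \<in> gen_congruence Q"
  using equiv_gen_congruence[of Q] by (simp add: equiv_def refl_on_def)

lemma gen_congruence_relation: "(u, v) \<in> Q \<Longrightarrow> (u, v) \<in> gen_congruence Q"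
  unfolding gen_congruence_def by blast

lemma gen_congruence_least:
  "word_congruence \<rho> \<Longrightarrow> Q \<subseteq> \<rho> \<Longrightarrow> gen_congruence Q \<subseteq> \<rho>"
  unfolding gen_congruence_def by blast

lemma gen_congruence_class_eq_iff:
  "gen_congruence Q `` {u} = gen_congruence Q `` {v} \<longleftrightarrow> (u, v) \<in> gen_congruence Q"
  using eq_equiv_class_iff[OF equiv_gen_congruence UNIV_I UNIV_I] .

lemma presented_monoid_mult:
  "mult (presented_monoid Q) (gen_congruence Q `` {u}) (gen_congruence Q `` {v}) =
   gen_congruence Q `` {u @ v}"
proof -
  have "gen_congruence Q `` {u' @ v'} = gen_congruence Q `` {u @ v}"
    if "(u, u') \<in> gen_congruence Q" "(v, v') \<in> gen_congruence Q" for u' v'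
    using gen_congruence_append[OF that] gen_congruence_class_eq_iff by blast
  then show ?thesis
    unfolding presented_monoid_def by (simp, use gen_congruence_refl in blast)
qed

lemma defined_by_presentationI:
  assumes M: "monoid M"
    and range: "range ev = carrier M"
    and append: "\<And>u v. ev (u @ v) = ev u \<otimes>\<^bsub>M\<^esub> ev v"
    and kernel: "\<And>u v. ev u = ev v \<longleftrightarrow> (u, v) \<in> gen_congruence Q"
    and letters: "\<And>b. ev [b] = f b"
  shows "defined_by_presentation M f Q"
proof -
  \<comment> \<open>By \<open>kernel\<close>, \<open>ev\<close> is constant on classes, so the
    choice of representative is immaterial.\<close>
  define \<phi> where "\<phi> X = ev (SOME w. w \<in> X)" for X
  have \<phi>: "\<phi> (gen_congruence Q `` {w}) = ev w" for w
  proof -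
    have "(SOME v. v \<in> gen_congruence Q `` {w}) \<in> gen_congruence Q `` {w}"
      by (rule someI[of "\<lambda>v. v \<in> gen_congruence Q `` {w}" w]) (simp add: gen_congruence_refl)
    then have "(w, SOME v. v \<in> gen_congruence Q `` {w}) \<in> gen_congruence Q"
      by (simp only: Image_singleton_iff)
    then show ?thesis
      unfolding \<phi>_def by (simp only: kernel[symmetric])
  qed
  have carrier: "carrier (presented_monoid Q) = range (\<lambda>w. gen_congruence Q `` {w})"
    by (auto simp: presented_monoid_def quotient_def)
  have "\<phi> \<in> iso (presented_monoid Q) M"
  proof (rule isoI)
    show "\<phi> \<in> hom (presented_monoid Q) M"
      unfolding hom_def carrier range[symmetric]
      by (auto simp: \<phi> presented_monoid_mult append[symmetric])
    show "bij_betw \<phi> (carrier (presented_monoid Q)) (carrier M)"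
      unfolding bij_betw_def inj_on_def carrier range[symmetric]
      by (simp add: \<phi> kernel gen_congruence_class_eq_iff image_image)
  qed
  moreover have "\<forall>b. \<phi> (gen_congruence Q `` {[b]}) = f b"
    by (simp only: \<phi> letters simp_thms)
  ultimately show ?thesis
    unfolding defined_by_presentation_def using M by blast
qed

text \<open>By the Cayley representation it suffices to study the relations in types of class
  \<^class>\<open>monoid_mult\<close>, where no carrier sets are needed.\<close>

typedef 'a endo = "UNIV :: ('a \<Rightarrow> 'a) set"
  morphisms apply_endo Endo by simp

instantiation endo :: (type) monoid_mult
begin

definition "1 = Endo id"
definition "a * b = Endo (apply_endo a \<circ> apply_endo b)"

instance
  by standard
    (simp_all add: one_endo_def times_endo_def Endo_inverse apply_endo_inverse o_assoc)

end

text \<open>A hypothesis cannot range over all monoid types, so a single type rich enough for the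
  Cayley representation of the quotient serves as test.\<close>

lemma gen_congruence_complete:
  fixes u v :: "'b list"
  assumes "\<And>f :: 'b \<Rightarrow> 'b list set endo.
    (\<And>p q. (p, q) \<in> Q \<Longrightarrow> prod_list (map f p) = prod_list (map f q)) \<Longrightarrow>
    prod_list (map f u) = prod_list (map f v)"
  shows "(u, v) \<in> gen_congruence Q"
proof -
  let ?\<rho> = "gen_congruence Q"
  \<comment> \<open>Left multiplication by a letter on congruence classes. Sets that are not classes
    stay fixed, so that the relations hold on the whole type.\<close>
  define f :: "'b \<Rightarrow> 'b list set endo" where
    "f b = Endo (\<lambda>X. if X \<in> UNIV // ?\<rho> then ?\<rho> `` ((#) b ` X) else X)" for b
  have class_image: "?\<rho> `` ((@) p ` (?\<rho> `` {w})) = ?\<rho> `` {p @ w}" for p w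
  proof -
    have "?\<rho> `` {p @ w'} = ?\<rho> `` {p @ w}" if "(w, w') \<in> ?\<rho>" for w'
      using gen_congruence_append[OF gen_congruence_refl that] gen_congruence_class_eq_iff
      by blast
    then show ?thesis
      using gen_congruence_refl by fast
  qed
  have class_eval: "apply_endo (prod_list (map f p)) (?\<rho> `` {w}) = ?\<rho> `` {p @ w}" for p w
  proof (induction p)
    case Nil
    then show ?case by (simp add: one_endo_def Endo_inverse)
  next
    case (Cons b p)
    have "?\<rho> `` {p @ w} \<in> UNIV // ?\<rho>" by (simp add: quotientI)
    then show ?case
      using Cons class_image[of "[b]" "p @ w"]
      by (simp add: f_def times_endo_def Endo_inverse)
  qed
  have other_eval: "apply_endo (prod_list (map f p)) X = X" if "X \<notin> UNIV // ?\<rho>" for p X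
    using that by (induction p) (simp_all add: f_def times_endo_def one_endo_def Endo_inverse)
  have "prod_list (map f p) = prod_list (map f q)" if "(p, q) \<in> Q" for p q
  proof -
    have "apply_endo (prod_list (map f p)) X = apply_endo (prod_list (map f q)) X" for X
    proof (cases "X \<in> UNIV // ?\<rho>")
      case True
      then obtain w where "X = ?\<rho> `` {w}" by (auto elim: quotientE)
      then show ?thesis
        using gen_congruence_append[OF gen_congruence_relation[OF that] gen_congruence_refl]
        by (simp add: class_eval gen_congruence_class_eq_iff)
    qed (simp add: other_eval)
    then show ?thesis
      by (metis apply_endo_inverse ext)
  qed
  then have "prod_list (map f u) = prod_list (map f v)" by (rule assms)
  \<comment> \<open>Evaluation at the class of the empty word returns the classes of
    \<open>u\<close> and \<open>v\<close>.\<close>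
  then show ?thesis
    using class_eval[of u "[]"] class_eval[of v "[]"]
    by (simp flip: gen_congruence_class_eq_iff)
qed


section \<open>The action of words on the integers modulo \<open>n\<close>\<close>

text \<open>Vertices are lifted to integers: \<open>g\<close> is \<open>i \<mapsto> i + 1\<close>, \<open>h\<close> is \<open>i \<mapsto> 1 - i\<close>, and \<open>e\<close> is
  undefined on the multiples of \<open>n\<close>. No value is ever reduced modulo \<open>n\<close>.\<close>

fun word_act :: "nat \<Rightarrow> letter list \<Rightarrow> int \<Rightarrow> int option" where
  "word_act n [] i = Some i"
| "word_act n (Lg # w) i = word_act n w (i + 1)"
| "word_act n (Lh # w) i = word_act n w (1 - i)"
| "word_act n (Le # w) i = (if int n dvd i then None else word_act n w i)"

text \<open>Shifting by 1 before and after the reduction gives representatives 1, ..., n; multiples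
  of n go to n, the vertex deleted by \<open>e\<close>.\<close>

definition vertex :: "nat \<Rightarrow> int \<Rightarrow> nat" where
  "vertex n i = nat ((i - 1) mod int n) + 1"

fun word_map :: "nat \<Rightarrow> letter list \<Rightarrow> (nat \<rightharpoonup> nat)" where
  "word_map n [] = Some |` {1..n}"
| "word_map n (b # w) = word_map n w \<circ>\<^sub>m letter_map n b"

lemma word_act_append: "word_act n (u @ v) i = Option.bind (word_act n u i) (word_act n v)"
  by (induction n u i rule: word_act.induct) auto

lemma wpow_0: "wpow w 0 = []" and wpow_Suc: "wpow w (Suc k) = w @ wpow w k"
  by (simp_all add: wpow_def)

lemma word_act_wpow_g: "word_act n (wpow [Lg] m) i = Some (i + int m)"
  by (induction m arbitrary: i) (auto simp: wpow_0 wpow_Suc)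

lemma word_act_wpow_eg:
  "word_act n (wpow [Le, Lg] m) i =
   (if \<exists>j<m. int n dvd i + int j then None else Some (i + int m))"
proof (induction m arbitrary: i)
  case 0
  then show ?case by (simp add: wpow_0)
next
  case (Suc m)
  have "(\<exists>j<Suc m. int n dvd i + int j) \<longleftrightarrow> int n dvd i \<or> (\<exists>j<m. int n dvd i + 1 + int j)"
    unfolding Ex_less_Suc2 by (simp add: add_ac)
  with Suc show ?case by (auto simp: wpow_Suc)
qed

lemma vertex_in: "n > 0 \<Longrightarrow> vertex n i \<in> {1..n}"
proof -
  assume "n > 0"
  then have "0 \<le> (i - 1) mod int n" "(i - 1) mod int n < int n" by auto
  then show ?thesis unfolding vertex_def by auto
qed

lemma vertex_int: "x \<in> {1..n} \<Longrightarrow> vertex n (int x) = x"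
  unfolding vertex_def by (simp add: nat_diff_distrib)

lemma dvd_vertex_diff: "n > 0 \<Longrightarrow> int n dvd int (vertex n i) - i"
proof -
  assume "n > 0"
  then have "int (vertex n i) - i = - ((i - 1) - (i - 1) mod int n)"
    unfolding vertex_def by simp
  then show ?thesis by (simp only: dvd_minus_iff dvd_minus_mod)
qed

lemma vertex_eq_iff: "n > 0 \<Longrightarrow> vertex n i = vertex n j \<longleftrightarrow> int n dvd i - j"
proof -
  assume "n > 0"
  then have "vertex n i = vertex n j \<longleftrightarrow> (i - 1) mod int n = (j - 1) mod int n"
    unfolding vertex_def by (auto simp: eq_nat_nat_iff)
  then show ?thesis by (simp add: mod_eq_dvd_iff)
qed

lemma vertex_eqI: "y \<in> {1..n} \<Longrightarrow> int n dvd int y - i \<Longrightarrow> vertex n i = y"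
  using vertex_eq_iff[of n "int y" i] vertex_int[of y n] by auto

lemma dvd_shift: "(d::int) dvd a - b \<Longrightarrow> d dvd a \<longleftrightarrow> d dvd b"
  using dvd_add_left_iff[of d "a - b" b] by simp

lemma letter_map_g: "n > 0 \<Longrightarrow> letter_map n Lg (vertex n i) = Some (vertex n (i + 1))"
proof -
  assume n: "n > 0"
  let ?x = "vertex n i"
  have "vertex n (i + 1) = (if ?x < n then ?x + 1 else 1)"
  proof (rule vertex_eqI)
    \<comment> \<open>Wrapping from n to 1 subtracts n, which divisibility by n does not
      see.\<close>
    have "int n dvd (int ?x - i) + (if ?x < n then 0 else - int n)"
      using dvd_vertex_diff[OF n, of i] by (rule dvd_add) simp
    also have "\<dots> = int (if ?x < n then ?x + 1 else 1) - (i + 1)"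
      using vertex_in[OF n, of i] by (cases "?x < n") auto
    finally show "int n dvd int (if ?x < n then ?x + 1 else 1) - (i + 1)" .
  qed (use n in simp)
  then show ?thesis using vertex_in[OF n, of i] by auto
qed

lemma letter_map_h: "n > 0 \<Longrightarrow> letter_map n Lh (vertex n i) = Some (vertex n (1 - i))"
proof -
  assume n: "n > 0"
  let ?x = "vertex n i"
  have x: "?x \<in> {1..n}" using vertex_in[OF n] .
  have "vertex n (1 - i) = n + 1 - ?x"
  proof (rule vertex_eqI)
    have "int n dvd int n - (int ?x - i)"
      using dvd_vertex_diff[OF n, of i] by (rule dvd_diff[OF dvd_refl])
    then show "int n dvd int (n + 1 - ?x) - (1 - i)"
      using x by (simp add: of_nat_diff algebra_simps)
  qed (use x in auto)
  then show ?thesis using x by auto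
qed

lemma vertex_eq_n_iff: "n > 0 \<Longrightarrow> vertex n i = n \<longleftrightarrow> int n dvd i"
  using vertex_eq_iff[of n i "int n"] vertex_int[of n n] dvd_diff_left_iff[of "int n" "int n" i]
  by auto

lemma letter_map_e:
  "n > 0 \<Longrightarrow> letter_map n Le (vertex n i) = (if int n dvd i then None else Some (vertex n i))"
  using vertex_in[of n i] vertex_eq_n_iff[of n i] by (auto simp: restrict_map_def)

text \<open>\<open>vertex\<close> intertwines the lifted action with the true one, letter by
  letter.\<close>

lemma word_map_vertex:
  "n > 0 \<Longrightarrow> word_map n w (vertex n i) = map_option (vertex n) (word_act n w i)"
proof (induction n w i rule: word_act.induct)
  case (1 n i)
  then show ?case using vertex_in by (auto simp: restrict_map_def)
qed (simp_all add: map_comp_def letter_map_g letter_map_h letter_map_e del: letter_map.simps)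

section \<open>Normal forms\<close>

definition meets :: "nat \<Rightarrow> int list \<Rightarrow> int \<Rightarrow> bool" where
  "meets n xs i \<longleftrightarrow> (\<exists>x\<in>set xs. int n dvd i - x)"

lemma meets_cong:
  assumes "int n dvd a - b"
  shows "meets n xs a \<longleftrightarrow> meets n xs b"
proof -
  have "int n dvd a - x \<longleftrightarrow> int n dvd b - x" for x
    using assms dvd_shift[of "int n" "a - x" "b - x"] by simp
  then show ?thesis by (simp add: meets_def)
qed

text \<open>An arbitrary monoid satisfying the relations: equalities of values derived here hold in
  the Cayley representation and so become congruences of words.\<close>

locale DPC_relations_model =
  fixes n :: nat and f :: "letter \<Rightarrow> 'a :: monoid_mult"
  assumes n_ge_3: "n \<ge> 3"
    and relation: "(u, v) \<in> DPC_relations n \<Longrightarrow> prod_list (map f u) = prod_list (map f v)"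
begin

lemma n_pos: "n > 0" using n_ge_3 by simp

abbreviation "ev w \<equiv> prod_list (map f w)"

lemma ev_wpow: "ev (wpow w k) = ev w ^ k"
  by (induction k) (simp_all add: wpow_0 wpow_Suc)

definition "g = f Lg"
definition "h = f Lh"
definition "e = f Le"

lemmas ghe_defs = g_def h_def e_def

text \<open>Reducing the exponent modulo n gives rotations integer exponents, hence inverses,
  although the type is only a monoid.\<close>

definition G :: "int \<Rightarrow> 'a" where "G k = g ^ nat (k mod int n)"

text \<open>The partial identity undefined at \<open>i\<close> modulo \<open>n\<close>.\<close>

definition E :: "int \<Rightarrow> 'a" where "E i = G (- i) * e * G i"

definition EL :: "int list \<Rightarrow> 'a" where "EL xs = prod_list (map E xs)"

text \<open>The dihedral element \<open>i \<mapsto> s * i + k\<close>, for \<open>s = 1\<close> or \<open>s = - 1\<close>.\<close>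

definition D :: "int \<Rightarrow> int \<Rightarrow> 'a" where "D s k = (if s = 1 then G k else h * G (k - 1))"

section \<open>Arithmetic of the dihedral part\<close>

lemma g_power_n: "g ^ n = 1"
  using relation[of "wpow [Lg] n" "[]"]
  by (simp add: DPC_relations_def Q1_def ev_wpow ghe_defs)

lemma g_power_mod: "g ^ m = g ^ (m mod n)"
proof -
  have "g ^ m = g ^ (n * (m div n) + m mod n)" by simp
  also have "\<dots> = g ^ (m mod n)" by (simp only: power_add power_mult g_power_n power_one mult_1_left)
  finally show ?thesis .
qed

lemma G_of_nat: "G (int m) = g ^ m"
  unfolding G_def using g_power_mod[of m] by (simp add: nat_mod_as_int)

lemma G_cong: "int n dvd a - b \<Longrightarrow> G a = G b"
  unfolding G_def by (simp add: mod_eq_dvd_iff[symmetric])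

lemma G_add: "G a * G b = G (a + b)"
proof -
  have "G a * G b = G (int (nat (a mod int n) + nat (b mod int n)))"
    unfolding G_of_nat by (simp add: G_def power_add)
  also have "\<dots> = G (a mod int n + b mod int n)"
    using n_pos by simp
  also have "\<dots> = G (a + b)"
    by (rule G_cong) (simp add: mod_eq_dvd_iff[symmetric] mod_simps)
  finally show ?thesis .
qed

lemma G_add_left: "G a * (G b * x) = G (a + b) * x"
  by (simp add: G_add mult.assoc[symmetric])

lemma G_0: "G 0 = 1" by (simp add: G_def)

lemma G_1: "G 1 = g" using G_of_nat[of 1] by simp

lemma G_minus_1: "G (- 1) = g ^ (n - 1)"
  using G_of_nat[of "n - 1"] G_cong[of "- 1" "int (n - 1)"] n_pos by (simp add: of_nat_diff)

lemma G_right_cancel: "x * G a = y * G a \<Longrightarrow> x = y"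
proof -
  assume "x * G a = y * G a"
  then have "x * G a * G (- a) = y * G a * G (- a)" by simp
  then show "x = y" by (simp add: mult.assoc G_add G_0)
qed

lemma h_h: "h * h = 1"
  using relation[of "[Lh, Lh]" "[]"] by (simp add: DPC_relations_def Q1_def ghe_defs)

lemma h_g: "h * g = G (- 1) * h"
  using relation[of "[Lh, Lg]" "wpow [Lg] (n - 1) @ [Lh]"]
  by (simp add: DPC_relations_def Q1_def ev_wpow ghe_defs G_minus_1[unfolded ghe_defs])

lemma h_g_power: "h * g ^ m = G (- int m) * h"
proof (induction m)
  case 0
  then show ?case by (simp add: G_0)
next
  case (Suc m)
  have "h * g ^ Suc m = G (- int m) * (h * g)"
    using Suc by (simp add: power_Suc2 mult.assoc[symmetric] del: power_Suc)
  also have "\<dots> = G (- int m + - 1) * h" by (simp only: h_g G_add_left)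
  finally show ?case by (simp add: algebra_simps)
qed

lemma h_G: "h * G k = G (- k) * h"
proof -
  have "h * G k = G (- (k mod int n)) * h"
    unfolding G_def[of k] h_g_power using n_pos by simp
  also have "G (- (k mod int n)) = G (- k)"
    by (rule G_cong) (simp add: mod_eq_dvd_iff[symmetric] mod_simps)
  finally show ?thesis .
qed

lemma h_G_left: "h * (G k * x) = G (- k) * (h * x)"
  by (simp add: h_G mult.assoc[symmetric])

lemma h_h_left: "h * (h * x) = x"
  by (simp add: h_h mult.assoc[symmetric])

section \<open>Deletions of single vertices\<close>

lemma e_e: "e * e = e"
  using relation[of "[Le, Le]" "[Le]"] by (simp add: DPC_relations_def Q2_def ghe_defs)

lemma e_e_left: "e * (e * x) = e * x"
  by (simp add: e_e mult.assoc[symmetric])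

lemma ghegh: "G 1 * (h * (e * (G 1 * h))) = e"
  using relation[of "[Lg, Lh, Le, Lg, Lh]" "[Le]"]
  by (simp add: DPC_relations_def Q2_def G_1 ghe_defs mult.assoc)

text \<open>As \<open>h\<close> exchanges n and 1, the deletion of n becomes the deletion of 1 when
  moved across it; this is the content of \<open>ghegh\<close>.\<close>

lemma e_h: "e * h = h * E 1"
proof -
  have "h * E 1 = h * (G (- 1) * (e * G 1)) * h * h"
    by (simp add: E_def mult.assoc h_h)
  also have "\<dots> = (G 1 * (h * (e * (G 1 * h)))) * h"
    by (simp add: mult.assoc h_G_left)
  finally show ?thesis by (simp add: ghegh)
qed

lemma E_cong: "int n dvd a - b \<Longrightarrow> E a = E b"
  unfolding E_def using G_cong[of a b] G_cong[of "- a" "- b"] by (simp add: dvd_diff_commute)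

lemma E_G: "E i * G k = G k * E (i + k)"
  by (simp add: E_def mult.assoc G_add G_add_left)

lemma E_h: "E i * h = h * E (1 - i)"
proof -
  have "E i * h = G (- i) * (e * h) * G (- i)"
    using h_G[of "- i"] by (simp add: E_def mult.assoc)
  also have "\<dots> = h * (G i * (G (- 1) * (e * (G 1 * G (- i)))))"
    unfolding e_h by (simp add: E_def mult.assoc h_G_left)
  also have "\<dots> = h * E (1 - i)"
    by (simp add: E_def mult.assoc G_add G_add_left)
  finally show ?thesis .
qed

lemma E_idem: "E i * E i = E i"
  by (simp add: E_def mult.assoc G_add_left G_0 e_e_left)

lemma e_E_commute:
  assumes "0 < d" "d < n"
  shows "e * E (- int d) = E (- int d) * e"
proof -
  \<comment> \<open>(Q3) involves i and j only through d = j - i, so i = 1, j = d + 1 is general.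
    Its block g^d e g^(n-d) is \<open>E (- int d)\<close>.\<close>
  have "(Le # wpow [Lg] d @ Le # wpow [Lg] (n - d),
         wpow [Lg] d @ Le # wpow [Lg] (n - d) @ [Le]) \<in> Q3 n"
    unfolding Q3_def mem_Collect_eq using assms
    by (intro exI[of _ 1] exI[of _ "d + 1"]) (auto simp: Suc_diff_Suc)
  from relation[of _ _] this
  have "e * g ^ d * e * g ^ (n - d) = g ^ d * e * g ^ (n - d) * e"
    by (force simp: DPC_relations_def ev_wpow ghe_defs mult.assoc)
  moreover have "g ^ (n - d) = G (- int d)"
    using G_of_nat[of "n - d"] G_cong[of "int (n - d)" "- int d"] assms by (simp add: of_nat_diff)
  ultimately show ?thesis
    by (simp add: E_def G_of_nat mult.assoc)
qed

lemma E_commute: "E a * E b = E b * E a"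
proof -
  \<comment> \<open>Conjugation by a rotation moves \<open>a\<close> to 0, where \<open>E\<close> is
    \<open>e\<close>, and \<open>b\<close> to \<open>b - a\<close>, which is congruent to
    \<open>- int d\<close> with \<open>d < n\<close>. For \<open>d = 0\<close> both deletions
    coincide.\<close>
  define d where "d = nat ((a - b) mod int n)"
  have d: "int d = (a - b) mod int n" "d < n"
    using n_pos by (simp_all add: d_def nat_less_iff)
  then have "int n dvd (b - a) - - int d"
    by (metis add.commute diff_minus_eq_add dvd_minus_iff dvd_minus_mod minus_add_distrib
        minus_diff_eq uminus_add_conv_diff)
  then have E: "E (b - a) = E (- int d)" by (rule E_cong)
  have *: "e * E (b - a) = E (b - a) * e"
  proof (cases "d = 0")
    case True
    then show ?thesis unfolding E by (simp add: E_def G_0)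
  next
    case False
    then show ?thesis using e_E_commute[of d] d by (simp add: E)
  qed
  have "E a * E b = G (- a) * (e * E (b - a)) * G a"
    using E_G[of "b - a" a] by (simp add: E_def[of a] mult.assoc)
  also have "\<dots> = G (- a) * E (b - a) * (e * G a)"
    by (simp only: * mult.assoc)
  also have "\<dots> = E b * E a"
    using E_G[of b "- a"] by (simp add: E_def[of a] mult.assoc[symmetric])
  finally show ?thesis .
qed

section \<open>Products of deletions\<close>

lemma EL_Nil: "EL [] = 1" and EL_Cons: "EL (x # xs) = E x * EL xs"
  and EL_append: "EL (xs @ ys) = EL xs * EL ys"
  by (simp_all add: EL_def)

lemma E_EL_commute: "E x * EL xs = EL xs * E x"
proof (induction xs)
  case (Cons y xs)
  have "E x * EL (y # xs) = E y * (E x * EL xs)"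
    by (simp add: EL_Cons mult.assoc[symmetric] E_commute[of x y])
  with Cons show ?case by (simp add: EL_Cons mult.assoc)
qed (simp add: EL_Nil)

lemma EL_commute: "EL xs * EL ys = EL ys * EL xs"
proof (induction xs)
  case (Cons x xs)
  have "EL (x # xs) * EL ys = E x * EL ys * EL xs"
    by (simp add: EL_Cons mult.assoc Cons)
  then show ?case by (simp add: EL_Cons mult.assoc E_EL_commute)
qed (simp add: EL_Nil)

lemma E_EL_absorb: "meets n xs i \<Longrightarrow> E i * EL xs = EL xs"
proof (induction xs)
  case (Cons x xs)
  show ?case
  proof (cases "int n dvd i - x")
    case True
    then show ?thesis
      using E_cong[of i x] by (simp add: EL_Cons mult.assoc[symmetric] E_idem)
  next
    case False
    with Cons have "E i * EL xs = EL xs" by (auto simp: meets_def)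
    then show ?thesis
      using E_commute[of i x] by (simp add: EL_Cons) (metis mult.assoc)
  qed
qed (simp add: meets_def)

lemma EL_absorb: "(\<And>x. x \<in> set ys \<Longrightarrow> meets n xs x) \<Longrightarrow> EL ys * EL xs = EL xs"
  by (induction ys) (simp_all add: EL_Nil EL_Cons mult.assoc E_EL_absorb)

lemma meets_self: "x \<in> set xs \<Longrightarrow> meets n xs x"
  unfolding meets_def by force

text \<open>Each product absorbs the other, and they commute: antisymmetry in the semilattice of
  deletions.\<close>

lemma EL_cong: "(\<And>i. meets n xs i \<longleftrightarrow> meets n ys i) \<Longrightarrow> EL xs = EL ys"
  using EL_absorb[of xs ys] EL_absorb[of ys xs] EL_commute[of xs ys] meets_self by metis

lemma EL_G: "EL xs * G k = G k * EL (map (\<lambda>x. x + k) xs)"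
proof (induction xs)
  case (Cons x xs)
  have "EL (x # xs) * G k = E x * G k * EL (map (\<lambda>x. x + k) xs)"
    by (simp add: EL_Cons mult.assoc Cons)
  then show ?case by (simp add: EL_Cons mult.assoc E_G)
qed (simp add: EL_Nil)

lemma EL_h: "EL xs * h = h * EL (map (\<lambda>x. 1 - x) xs)"
proof (induction xs)
  case (Cons x xs)
  have "EL (x # xs) * h = E x * h * EL (map (\<lambda>x. 1 - x) xs)"
    by (simp add: EL_Cons mult.assoc Cons)
  then show ?case by (simp add: EL_Cons mult.assoc E_h)
qed (simp add: EL_Nil)

lemma D_cong: "int n dvd k - l \<Longrightarrow> D s k = D s l"
  unfolding D_def using G_cong[of k l] G_cong[of "k - 1" "l - 1"] by simp

lemma G_D: "G t * D (- 1) c = D (- 1) (c - t)"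
  by (simp add: D_def mult.assoc[symmetric] h_G[of "- t", simplified, symmetric])
     (simp add: mult.assoc G_add algebra_simps)

lemma D_G: "D s c * G t = D s (c + t)"
  by (simp add: D_def mult.assoc G_add algebra_simps)

text \<open>One triple \<open>s\<close>, \<open>k\<close>, \<open>xs\<close> describes both the
  value and the action, so that comparing actions gives information on values. Deletion comes last,
  hence \<open>xs\<close> lists points missing from the image. A new last letter \<open>g\<close> or
  \<open>h\<close> moves left across \<open>EL\<close>, transporting \<open>xs\<close>, and merges
  with \<open>D\<close>; a new \<open>e\<close> is the deletion of 0.\<close>

lemma normal_form:
  obtains s k xs where "s = 1 \<or> s = - 1" "ev w = D s k * EL xs"
    "\<And>i. word_act n w i = (if meets n xs (s * i + k) then None else Some (s * i + k))"
proof -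
  have "\<exists>s k xs. (s = 1 \<or> s = - 1) \<and> ev w = D s k * EL xs \<and>
    (\<forall>i. word_act n w i = (if meets n xs (s * i + k) then None else Some (s * i + k)))"
  proof (induction w rule: rev_induct)
    case Nil
    have "ev [] = D 1 0 * EL []" by (simp add: D_def G_0 EL_Nil)
    moreover have "\<forall>i. word_act n [] i = (if meets n [] (1 * i + 0) then None else Some (1 * i + 0))"
      by (simp add: meets_def)
    ultimately show ?case by blast
  next
    case (snoc b w)
    then obtain s k xs where s: "s = 1 \<or> s = - 1" and ev: "ev w = D s k * EL xs" and
      act: "\<And>i. word_act n w i = (if meets n xs (s * i + k) then None else Some (s * i + k))"
      by blast
    show ?case
    proof (cases b)
      case Lg
      have "ev (w @ [b]) = D s (k + 1) * EL (map (\<lambda>x. x + 1) xs)"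
        using EL_G[of xs 1] by (simp add: Lg ev mult.assoc D_G[symmetric] G_1 ghe_defs)
      moreover have "\<forall>i. word_act n (w @ [b]) i =
        (if meets n (map (\<lambda>x. x + 1) xs) (s * i + (k + 1)) then None else Some (s * i + (k + 1)))"
        by (auto simp: Lg word_act_append act meets_def algebra_simps)
      ultimately show ?thesis using s by blast
    next
      case Lh
      have D_h: "D s k * h = D (- s) (1 - k)"
        using s h_G[of "- k"] by (auto simp: D_def mult.assoc h_G_left h_h)
      have "ev (w @ [b]) = D (- s) (1 - k) * EL (map (\<lambda>x. 1 - x) xs)"
        using EL_h[of xs] by (simp add: Lh ev mult.assoc D_h[symmetric] ghe_defs)
      moreover have "\<forall>i. word_act n (w @ [b]) i =
        (if meets n (map (\<lambda>x. 1 - x) xs) (- s * i + (1 - k)) then None else Some (- s * i + (1 - k)))"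
      proof
        fix i
        have "int n dvd s * i + k - x \<longleftrightarrow> int n dvd (- s * i + (1 - k)) - (1 - x)" for x
          using dvd_minus_iff[of "int n" "s * i + k - x"] by (simp add: algebra_simps)
        then show "word_act n (w @ [b]) i =
          (if meets n (map (\<lambda>x. 1 - x) xs) (- s * i + (1 - k)) then None else Some (- s * i + (1 - k)))"
          by (simp add: Lh word_act_append act meets_def)
      qed
      moreover have "- s = 1 \<or> - s = - 1" using s by auto
      ultimately show ?thesis by blast
    next
      case Le
      have "ev (w @ [b]) = D s k * EL (xs @ [0])"
        by (simp add: Le ev mult.assoc EL_append EL_Cons EL_Nil E_def G_0 ghe_defs)
      moreover have "\<forall>i. word_act n (w @ [b]) i =
        (if meets n (xs @ [0]) (s * i + k) then None else Some (s * i + k))"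
        by (auto simp: Le word_act_append act meets_def)
      ultimately show ?thesis using s by blast
    qed
  qed
  then show ?thesis using that by blast
qed

section \<open>Reflections absorbed by deletions\<close>

lemma eg_power: "(e * g) ^ m = EL (map (\<lambda>j. - int j) [0..<m]) * G (int m)"
proof (induction m)
  case 0
  then show ?case by (simp add: EL_Nil G_0)
next
  case (Suc m)
  have "(e * g) ^ Suc m = EL (map (\<lambda>j. - int j) [0..<m]) * (G (int m) * e * G 1)"
    by (simp add: power_Suc2 Suc mult.assoc G_1 del: power_Suc)
  \<comment> \<open>After m rotations \<open>e\<close> deletes the points that started at
    -m.\<close>
  also have "G (int m) * e * G 1 = E (- int m) * G (int (Suc m))"
    by (simp add: E_def mult.assoc G_add algebra_simps)
  finally show ?case by (simp add: EL_append EL_Cons EL_Nil mult.assoc)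
qed

lemma eg_power_e: "(e * g) ^ m * e = EL (map (\<lambda>j. - int j) [0..<Suc m]) * G (int m)"
proof -
  have "G (int m) * e = E (- int m) * G (int m)"
    by (simp add: E_def mult.assoc G_add G_0)
  then show ?thesis by (simp add: eg_power EL_append EL_Cons EL_Nil mult.assoc)
qed

text \<open>If the vertices outside \<open>xs\<close> are fixed points of the reflection \<open>i \<mapsto> c - i\<close>, then this
  reflection is trivial on them. Up to rotation, \<open>c\<close> is \<open>2\<close> or \<open>1\<close>.\<close>

lemma reflection_absorb_extend:
  assumes "D (- 1) c * EL ys = EL ys"
    and "\<And>y. y \<in> set ys \<Longrightarrow> \<not> int n dvd 2 * y - c"
    and "\<And>y. \<not> int n dvd 2 * y - c \<Longrightarrow> meets n xs y"
  shows "D (- 1) c * EL xs = EL xs"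
proof -
  have "EL ys * EL xs = EL xs" using assms by (intro EL_absorb) auto
  then show ?thesis using assms(1) by (metis mult.assoc)
qed

text \<open>The reflection is \<open>h\<close> itself. For even n it fixes no vertex, so every
  vertex must be deleted, as (eg)^(n-1) e does; this is the second relation of (Q5).\<close>

lemma reflection_absorb_1:
  assumes "even n"
    and "\<And>y. \<not> int n dvd 2 * y - 1 \<Longrightarrow> meets n xs y"
  shows "D (- 1) 1 * EL xs = EL xs"
proof (rule reflection_absorb_extend[OF _ _ assms(2)])
  let ?ys = "map (\<lambda>j. - int j) [0..<Suc (n - 1)]"
  have "h * ((e * g) ^ (n - 1) * e) = (e * g) ^ (n - 1) * e"
    using relation[of "[Lh] @ wpow [Le, Lg] (n - 1) @ [Le]" "wpow [Le, Lg] (n - 1) @ [Le]"] assms(1)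
    by (simp add: DPC_relations_def Q5_def ev_wpow ghe_defs)
  then show "D (- 1) 1 * EL ?ys = EL ?ys"
    unfolding eg_power_e mult.assoc[symmetric] by (auto simp: D_def G_0 dest!: G_right_cancel)
  show "\<not> int n dvd 2 * y - 1" for y
  proof
    assume "int n dvd 2 * y - 1"
    moreover have "even (int n)" using assms(1) by simp
    ultimately have "even (2 * y - 1)" by (rule dvd_trans[rotated])
    then show False by simp
  qed
qed

text \<open>The reflection i -> 2 - i is hg. It fixes only 1 for odd n, but 1 and n/2 + 1 for even
  n, hence the two different relations.\<close>

lemma reflection_absorb_2:
  assumes "\<And>y. \<not> int n dvd 2 * y - 2 \<Longrightarrow> meets n xs y"
  shows "D (- 1) 2 * EL xs = EL xs"
proof (cases "odd n")
  case True
  \<comment> \<open>The n - 1 residues 0, -1, ..., -(n-2) leave out only 1.\<close>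
  let ?ys = "map (\<lambda>j. - int j) [0..<Suc (n - 2)]"
  show ?thesis
  proof (rule reflection_absorb_extend[OF _ _ assms])
    have "h * (g * ((e * g) ^ (n - 2) * e)) = (e * g) ^ (n - 2) * e"
      using relation[of "[Lh, Lg] @ wpow [Le, Lg] (n - 2) @ [Le]" "wpow [Le, Lg] (n - 2) @ [Le]"] True
      by (simp add: DPC_relations_def Q4_def ev_wpow ghe_defs)
    then show "D (- 1) 2 * EL ?ys = EL ?ys"
      unfolding eg_power_e mult.assoc[symmetric]
      by (auto simp: D_def G_1 dest!: G_right_cancel)
    fix y assume "y \<in> set ?ys"
    then obtain j where "y = - int j" "j < Suc (n - 2)" by (auto simp del: upt_Suc)
    then have j: "j < n - 1" "y = - int j" using n_ge_3 by auto
    show "\<not> int n dvd 2 * y - 2"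
    proof
      assume "int n dvd 2 * y - 2"
      then have "int n dvd - (2 * y - 2)" by (simp only: dvd_minus_iff)
      also have "- (2 * y - 2) = int (2 * (j + 1))" by (simp add: j)
      finally have "n dvd 2 * (j + 1)" by (simp only: of_nat_dvd_iff)
      moreover have "coprime n 2" using True by simp
      ultimately have "n dvd j + 1" by (simp only: coprime_dvd_mult_right_iff)
      then show False using j dvd_imp_le[of n "j + 1"] by simp
    qed
  qed
next
  case False
  then obtain m where m: "n = 2 * m" by auto
  then have m2: "m \<ge> 2" using n_ge_3 by simp
  \<comment> \<open>The extra \<open>g\<close> in the middle of the word skips -(m-1), that is m +
    1. The result is two runs of m - 1 residues, from 0 and from -m downwards, leaving out m + 1 and
    1.\<close>
  let ?ys = "map (\<lambda>j. - int j) [0..<m - 1]"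
  let ?zs = "map (\<lambda>j. - int j) [0..<Suc (m - 2)]"
  let ?ys' = "?ys @ map (\<lambda>x. x + - int m) ?zs"
  let ?W = "(e * g) ^ (m - 1) * g * ((e * g) ^ (m - 2) * e)"
  have W: "?W = EL ?ys' * G (int m + int (m - 2))"
  proof -
    have "?W = EL ?ys * (G (int (m - 1)) * G 1 * (EL ?zs * G (int (m - 2))))"
      unfolding eg_power_e by (simp only: eg_power mult.assoc G_1)
    also have "G (int (m - 1)) * G 1 = G (int m)" using m2 by (simp add: G_add of_nat_diff)
    also have "G (int m) * (EL ?zs * G (int (m - 2))) =
      EL (map (\<lambda>x. x + - int m) ?zs) * G (int m + int (m - 2))"
      using EL_G[of "map (\<lambda>x. x + - int m) ?zs" "int m"]
      by (simp add: G_add[symmetric] mult.assoc[symmetric] o_def del: upt_Suc)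
    finally show ?thesis by (simp only: EL_append mult.assoc)
  qed
  show ?thesis
  proof (rule reflection_absorb_extend[OF _ _ assms])
    have "h * (g * ?W) = ?W"
      using relation[of "[Lh, Lg] @ wpow [Le, Lg] (m - 1) @ [Lg] @ wpow [Le, Lg] (m - 2) @ [Le]"
          "wpow [Le, Lg] (m - 1) @ [Lg] @ wpow [Le, Lg] (m - 2) @ [Le]"] m
      by (simp add: DPC_relations_def Q5_def ev_wpow ghe_defs mult.assoc)
    moreover have "D (- 1) 2 = h * g" by (simp add: D_def G_1)
    ultimately have "D (- 1) 2 * EL ?ys' * G (int m + int (m - 2)) = EL ?ys' * G (int m + int (m - 2))"
      unfolding W by (simp only: mult.assoc)
    then show "D (- 1) 2 * EL ?ys' = EL ?ys'" by (rule G_right_cancel)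
    fix y assume "y \<in> set ?ys'"
    then obtain j where j: "y = - int j" "j < m - 1 \<or> m \<le> j \<and> j < m + (m - 1)"
    proof (cases "y \<in> set ?ys")
      case False
      with \<open>y \<in> set ?ys'\<close> obtain i where "i < Suc (m - 2)" "y = - int (m + i)"
        by (auto simp del: upt_Suc)
      moreover have "Suc (m - 2) = m - 1" using m2 by simp
      ultimately have "y = - int (m + i)" "m \<le> m + i \<and> m + i < m + (m - 1)" by auto
      then show ?thesis using that[of "m + i"] by blast
    qed auto
    show "\<not> int n dvd 2 * y - 2"
    proof
      assume "int n dvd 2 * y - 2"
      then have "int n dvd - (2 * y - 2)" by (simp only: dvd_minus_iff)
      also have "- (2 * y - 2) = int (2 * (j + 1))" by (simp add: j)
      \<comment> \<open>\<open>j + 1\<close> ranges over 1, ..., m - 1 and m + 1, ..., 2m - 1, which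
        contain no multiple of m.\<close>
      finally have "m dvd j + 1" unfolding m by (simp only: of_nat_dvd_iff nat_mult_dvd_cancel1)
      moreover have "\<not> m dvd j + 1" if "j < m - 1"
        using that dvd_imp_le[of m "j + 1"] by auto
      moreover have "\<not> m dvd j + 1" if "m \<le> j" "j < m + (m - 1)"
      proof
        assume "m dvd j + 1"
        then have "m dvd j + 1 - m" by simp
        then show False using that dvd_imp_le[of m "j + 1 - m"] by auto
      qed
      ultimately show False using j by blast
    qed
  qed
qed

text \<open>Conjugation by the rotation through \<open>t\<close> turns i -> c - i into i -> c + 2t -
  i and translates the deleted points; the first premise is therefore needed for all lists.\<close>

lemma reflection_absorb_shift:
  assumes "\<And>xs. (\<And>y. \<not> int n dvd 2 * y - c \<Longrightarrow> meets n xs y) \<Longrightarrow> D (- 1) c * EL xs = EL xs"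
    and "\<And>y. \<not> int n dvd 2 * y - (c + 2 * t) \<Longrightarrow> meets n xs y"
  shows "D (- 1) (c + 2 * t) * EL xs = EL xs"
proof -
  let ?ys = "map (\<lambda>x. x - t) xs"
  have "meets n ?ys y" if "\<not> int n dvd 2 * y - c" for y
  proof -
    have "\<not> int n dvd 2 * (y + t) - (c + 2 * t)" using that by (simp add: algebra_simps)
    from assms(2)[OF this] show ?thesis by (auto simp: meets_def algebra_simps)
  qed
  then have absorb: "D (- 1) c * EL ?ys = EL ?ys" by (rule assms(1))
  have EL: "EL ?ys * G t = G t * EL xs"
    using EL_G[of ?ys t] by (simp add: o_def)
  have "D (- 1) (c + 2 * t) = G (- t) * D (- 1) c * G t"
    by (simp add: G_D D_G add.commute)
  then have "D (- 1) (c + 2 * t) * EL xs = G (- t) * (D (- 1) c * (G t * EL xs))"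
    by (simp add: mult.assoc)
  also have "\<dots> = G (- t) * (G t * EL xs)"
    using absorb by (simp add: EL[symmetric] mult.assoc[symmetric])
  finally show ?thesis by (simp add: G_add_left G_0)
qed

lemma reflection_absorb:
  assumes "\<And>y. \<not> int n dvd 2 * y - c \<Longrightarrow> meets n xs y"
  shows "D (- 1) c * EL xs = EL xs"
proof -
  have even_case: "D (- 1) c * EL xs = EL xs"
    if "even c" "\<And>y. \<not> int n dvd 2 * y - c \<Longrightarrow> meets n xs y" for c
  proof -
    obtain r where "c = 2 * r" using \<open>even c\<close> by (elim evenE)
    then obtain t where "c = 2 + 2 * t" by (auto intro: that[of "r - 1"])
    then show ?thesis
      using reflection_absorb_shift[of 2 t xs] reflection_absorb_2 that(2) by blast
  qed
  show ?thesis
  proof (cases "even c")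
    case False
    show ?thesis
    proof (cases "even n")
      case True
      obtain t where "c = 1 + 2 * t" using False by (auto elim!: oddE)
      then show ?thesis
        using reflection_absorb_shift[of 1 t xs] reflection_absorb_1[OF True] assms by blast
    next
      case odd: False
      \<comment> \<open>For odd n, adding n to \<open>c\<close> changes its parity but not the
        reflection.\<close>
      have "D (- 1) (c + int n) * EL xs = EL xs"
      proof (rule even_case)
        show "meets n xs y" if "\<not> int n dvd 2 * y - (c + int n)" for y
          using that assms[of y] dvd_diff_left_iff[of "int n" "int n" "2 * y - c"]
          by (simp add: algebra_simps)
      qed (use False odd in simp)
      then show ?thesis using D_cong[of "c + int n" c "- 1"] by simp
    qed
  qed (use even_case assms in blast)
qed

text \<open>A rotation is a product of two reflections, and once all vertices are deleted both are
  absorbed.\<close>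

lemma rotation_absorb:
  assumes "\<And>y. meets n xs y"
  shows "G k * EL xs = EL xs"
proof -
  have "G k = D (- 1) 1 * D (- 1) (k + 1)"
    by (simp add: D_def G_0 h_h_left)
  then show ?thesis using reflection_absorb assms by (simp add: mult.assoc)
qed

text \<open>Values of \<open>word_act\<close> are never reduced, so agreement is required modulo n
  only. The action reveals the deleted set, and then the dihedral part up to what \<open>EL\<close>
  absorbs.\<close>

lemma word_act_determines_ev:
  assumes act: "\<And>i. rel_option (\<lambda>a b. int n dvd a - b) (word_act n u i) (word_act n v i)"
  shows "ev u = ev v"
proof -
  obtain s k xs where s: "s = 1 \<or> s = - 1" and u: "ev u = D s k * EL xs"
    "\<And>i. word_act n u i = (if meets n xs (s * i + k) then None else Some (s * i + k))"
    using normal_form[of u] by blast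
  obtain s' k' ys where s': "s' = 1 \<or> s' = - 1" and v: "ev v = D s' k' * EL ys"
    "\<And>i. word_act n v i = (if meets n ys (s' * i + k') then None else Some (s' * i + k'))"
    using normal_form[of v] by blast
  have meets_iff: "meets n xs (s * i + k) \<longleftrightarrow> meets n ys (s' * i + k')" for i
    using act[of i] by (auto simp: u v split: if_splits)
  have agree: "int n dvd (s * i + k) - (s' * i + k')" if "\<not> meets n xs (s * i + k)" for i
    using act[of i] that by (auto simp: u v split: if_splits)
  have solve: "\<exists>i. y = s * i + k" "\<exists>i. y = s' * i + k'" for y
    using s s' by (auto intro: exI[of _ "y - k"] exI[of _ "k - y"] exI[of _ "y - k'"] exI[of _ "k' - y"])
  \<comment> \<open>The starting point sent to \<open>y\<close> by one of the two dihedral maps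
    transfers the question to the other list, as surviving images agree modulo n.\<close>
  have "meets n xs y \<longleftrightarrow> meets n ys y" for y
  proof (cases "meets n xs y")
    case True
    show ?thesis
    proof (rule ccontr)
      assume neq: "\<not> ?thesis"
      obtain i where i: "y = s' * i + k'" using solve by blast
      have fresh: "\<not> meets n xs (s * i + k)" using True neq meets_iff[of i] i by simp
      with agree[of i] meets_cong[of n "s * i + k" y xs] True i show False by simp
    qed
  next
    case False
    obtain i where i: "y = s * i + k" using solve by blast
    with False agree[of i] meets_iff[of i] meets_cong[of n y "s' * i + k'" ys] show ?thesis by auto
  qed
  then have EL: "EL xs = EL ys" by (rule EL_cong)
  \<comment> \<open>With equal signs, agreement at a single point forces equal offsets modulo n;
    otherwise everything is deleted.\<close>
  have same: "D t a * EL xs = D t b * EL xs" if "\<And>y. meets n xs y \<or> int n dvd a - b" for t a b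
  proof (cases "int n dvd a - b")
    case True
    then show ?thesis using D_cong by metis
  next
    case False
    then have "G c * EL xs = EL xs" for c using that rotation_absorb by blast
    then show ?thesis by (simp add: D_def mult.assoc)
  qed
  \<comment> \<open>For the image y = i + a the agreement reads 2y = a + b modulo n:
    \<open>y\<close> is fixed by the reflection with constant \<open>b + a\<close>.\<close>
  have opposite: "D 1 a * EL xs = D (- 1) b * EL xs"
    if "\<And>i. \<not> meets n xs (i + a) \<Longrightarrow> int n dvd (i + a) - (- i + b)" for a b
  proof -
    have "D (- 1) (b + a) * EL xs = EL xs"
    proof (rule reflection_absorb)
      fix y assume "\<not> int n dvd 2 * y - (b + a)"
      then show "meets n xs y" using that[of "y - a"] by (auto simp: algebra_simps)
    qed
    then have "D 1 a * EL xs = G a * D (- 1) (b + a) * EL xs"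
      by (simp add: D_def mult.assoc)
    then show ?thesis by (simp add: G_D)
  qed
  have "D s k * EL xs = D s' k' * EL xs"
  proof (cases "s = s'")
    case True
    show ?thesis unfolding True
    proof (rule same)
      fix y
      obtain i where "y = s * i + k" using solve by blast
      with agree[of i] True show "meets n xs y \<or> int n dvd k - k'" by auto
    qed
  next
    case False
    with s s' consider "s = 1" "s' = - 1" | "s = - 1" "s' = 1" by auto
    then show ?thesis
    proof cases
      case 1
      then show ?thesis using opposite[of k k'] agree by simp
    next
      case 2
      have "int n dvd (i + k') - (- i + k)" if "\<not> meets n xs (i + k')" for i
      proof -
        have "\<not> meets n xs (s * i + k)" using that 2 meets_iff[of i] \<open>\<And>y. meets n xs y \<longleftrightarrow> meets n ys y\<close> by simp
        from agree[OF this] 2 have "int n dvd (- i + k) - (i + k')" by simp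
        then show ?thesis by (simp only: dvd_diff_commute)
      qed
      then show ?thesis using opposite[of k' k] 2 by simp
    qed
  qed
  then show ?thesis by (simp add: u v EL)
qed

end


section \<open>The words as partial isometries\<close>

lemma map_option_vertex_eq_iff:
  "n > 0 \<Longrightarrow> map_option (vertex n) a = map_option (vertex n) b \<longleftrightarrow>
    rel_option (\<lambda>i j. int n dvd i - j) a b"
  by (cases a; cases b) (simp_all add: vertex_eq_iff)

lemma word_map_outside: "x \<notin> {1..n} \<Longrightarrow> word_map n w x = None"
proof (cases w)
  case (Cons b w')
  moreover assume "x \<notin> {1..n}"
  then have "letter_map n b x = None" by (cases b) (auto simp: restrict_map_def)
  ultimately show ?thesis by simp
qed auto

lemma word_map_eq_iff:
  assumes "n > 0"
  shows "word_map n u = word_map n v \<longleftrightarrow>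
    (\<forall>i. rel_option (\<lambda>a b. int n dvd a - b) (word_act n u i) (word_act n v i))"
proof -
  have "word_map n u = word_map n v \<longleftrightarrow>
    (\<forall>i. word_map n u (vertex n i) = word_map n v (vertex n i))"
  proof
    assume *: "\<forall>i. word_map n u (vertex n i) = word_map n v (vertex n i)"
    show "word_map n u = word_map n v"
    proof
      fix x
      show "word_map n u x = word_map n v x"
      proof (cases "x \<in> {1..n}")
        case True
        then show ?thesis using *[rule_format, of "int x"] by (simp only: vertex_int)
      qed (metis word_map_outside)
    qed
  qed simp
  then show ?thesis using assms by (simp add: word_map_vertex map_option_vertex_eq_iff)
qed

lemma word_map_append: "word_map n (u @ v) = word_map n v \<circ>\<^sub>m word_map n u"
proof (induction u)
  case Nil
  show ?case
  proof
    fix x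
    show "word_map n ([] @ v) x = (word_map n v \<circ>\<^sub>m word_map n []) x"
      using word_map_outside[of x n v] by (cases "x \<in> {1..n}") (simp_all add: map_comp_def)
  qed
next
  case (Cons b u)
  then show ?case by (auto simp: map_comp_def fun_eq_iff split: option.split)
qed

section \<open>Validity of the relations for the action\<close>

lemma ex_dvd_add:
  assumes "n > 0"
  shows "\<exists>j<n. int n dvd i + int j"
proof (intro exI conjI)
  show "nat ((- i) mod int n) < n" using assms by (simp add: nat_less_iff)
  have "int n dvd (- i) - (- i) mod int n" by (rule dvd_minus_mod)
  then have "int n dvd - ((- i) - (- i) mod int n)" by (simp only: dvd_minus_iff)
  then show "int n dvd i + int (nat ((- i) mod int n))" using assms by (simp add: add.commute)
qed

lemma word_act_wpow_eg_e:
  "word_act n (wpow [Le, Lg] m @ [Le]) i =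
   (if \<exists>j<Suc m. int n dvd i + int j then None else Some (i + int m))"
  by (auto simp: word_act_append word_act_wpow_eg less_Suc_eq)

text \<open>Exactly one of the n consecutive integers i, ..., i + n - 1 is a multiple of n; the last
  one, congruent to i - 1, is left out.\<close>

lemma no_hit_but_one_iff:
  assumes "n > 0"
  shows "(\<exists>j<n - 1. int n dvd i + int j) \<longleftrightarrow> \<not> int n dvd i - 1"
proof
  assume "\<exists>j<n - 1. int n dvd i + int j"
  then obtain j where j: "j < n - 1" "int n dvd i + int j" by blast
  show "\<not> int n dvd i - 1"
  proof
    assume "int n dvd i - 1"
    with j(2) have "int n dvd (i + int j) - (i - 1)" by (rule dvd_diff)
    also have "(i + int j) - (i - 1) = int (j + 1)" by simp
    finally have "n dvd j + 1" by (simp only: of_nat_dvd_iff)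
    then show False using j(1) dvd_imp_le[of n "j + 1"] by simp
  qed
next
  assume *: "\<not> int n dvd i - 1"
  obtain j where j: "j < n" "int n dvd i + int j" using ex_dvd_add[OF assms] by blast
  have "j \<noteq> n - 1"
  proof
    assume "j = n - 1"
    then have "i + int j - int n = i - 1" using assms by (simp add: of_nat_diff)
    with dvd_diff[OF j(2) dvd_refl] show False using * by (simp only:)
  qed
  with j show "\<exists>j<n - 1. int n dvd i + int j" by (intro exI[of _ j]) auto
qed

text \<open>Modulo m the two runs coincide, which leads back to the previous count. Conversely, the
  parity of the quotient by m tells which run meets a multiple of n.\<close>

lemma no_hit_but_antipodes_iff:
  assumes n: "n = 2 * m" and "m > 0"
  shows "(\<exists>j<m - 1. int n dvd i + int j) \<or> (\<exists>j<m - 1. int n dvd i + int m + int j) \<longleftrightarrow>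
    \<not> int m dvd i - 1"
proof
  assume "(\<exists>j<m - 1. int n dvd i + int j) \<or> (\<exists>j<m - 1. int n dvd i + int m + int j)"
  then have "\<exists>j<m - 1. int m dvd i + int j"
  proof (elim disjE exE conjE)
    fix j assume j: "j < m - 1" "int n dvd i + int j"
    then show ?thesis unfolding n using dvd_trans[of "int m" "int (2 * m)"] by auto
  next
    fix j assume j: "j < m - 1" "int n dvd i + int m + int j"
    have "int m dvd int n" by (simp add: n)
    then have "int m dvd i + int m + int j" using j(2) by (rule dvd_trans)
    then have "int m dvd (i + int m + int j) - int m" by (rule dvd_diff) simp
    then show ?thesis using j(1) by auto
  qed
  then show "\<not> int m dvd i - 1" using no_hit_but_one_iff[OF \<open>m > 0\<close>, of i] by blast
next
  assume "\<not> int m dvd i - 1"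
  then obtain j where j: "j < m - 1" "int m dvd i + int j"
    using no_hit_but_one_iff[OF \<open>m > 0\<close>, of i] by blast
  from j(2) obtain q where q: "i + int j = int m * q" by (elim dvdE)
  show "(\<exists>j<m - 1. int n dvd i + int j) \<or> (\<exists>j<m - 1. int n dvd i + int m + int j)"
  proof (cases "even q")
    case True
    then have "int n dvd i + int j" by (auto simp: q n elim!: evenE)
    then show ?thesis using j by blast
  next
    case False
    then obtain r where "q = 2 * r + 1" by (elim oddE)
    then have "i + int m + int j = int n * (r + 1)" using q by (simp add: n algebra_simps)
    then have "int n dvd i + int m + int j" by simp
    then show ?thesis using j by blast
  qed
qed

lemma word_act_relation:
  assumes "n \<ge> 3" "(u, v) \<in> DPC_relations n"
  shows "rel_option (\<lambda>a b. int n dvd a - b) (word_act n u i) (word_act n v i)"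
proof -
  consider "(u, v) \<in> Q1 n" | "(u, v) \<in> Q2" | "(u, v) \<in> Q3 n" | "(u, v) \<in> Q4 n" | "(u, v) \<in> Q5 n"
    using assms(2) by (auto simp: DPC_relations_def)
  then show ?thesis
  proof cases
    case 1
    then show ?thesis
      using assms(1) by (auto simp: Q1_def word_act_append word_act_wpow_g of_nat_diff)
  next
    case 2
    then show ?thesis by (auto simp: Q2_def)
  next
    case 3
    then obtain p q where pq: "1 \<le> p" "p < q" "q \<le> n"
      and uv: "u = [Le] @ wpow [Lg] (q - p) @ [Le] @ wpow [Lg] (n - q + p)"
        "v = wpow [Lg] (q - p) @ [Le] @ wpow [Lg] (n - q + p) @ [Le]"
      unfolding Q3_def by auto
    \<comment> \<open>The two rotations make up a full turn, so the deletion test after them is the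
      one at \<open>i\<close>.\<close>
    have "int (q - p) + int (n - q + p) = int n" using pq by simp
    then have "i + int (q - p) + int (n - q + p) = i + int n" by simp
    then show ?thesis by (simp add: uv word_act_append word_act_wpow_g)
  next
    case 4
    have act: "word_act n (wpow [Le, Lg] (n - 2) @ [Le]) i =
        (if int n dvd i - 1 then Some (i + int (n - 2)) else None)" for i
    proof -
      have "Suc (n - 2) = n - 1" using assms(1) by simp
      then show ?thesis
        using assms(1) no_hit_but_one_iff[of n i] by (simp add: word_act_wpow_eg_e)
    qed
    have "int n dvd 1 - i \<longleftrightarrow> int n dvd i - 1" by (rule dvd_diff_commute)
    moreover have "int n dvd 2 - 2 * i" if "int n dvd i - 1"
    proof -
      have "int n dvd (- 2) * (i - 1)" using that by (rule dvd_mult)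
      then show ?thesis by simp
    qed
    ultimately show ?thesis using 4 by (auto simp: Q4_def act split: if_splits)
  next
    case 5
    then have "even n" by (auto simp: Q5_def split: if_splits)
    then obtain m where n: "n = 2 * m" by auto
    then have m: "m \<ge> 2" using assms(1) by simp
    let ?w = "wpow [Le, Lg] (m - 1) @ [Lg] @ wpow [Le, Lg] (m - 2) @ [Le]"
    have act: "word_act n ?w i =
        (if int m dvd i - 1 then Some (i + int m + int (m - 2)) else None)" for i
    proof -
      have "Suc (m - 2) = m - 1" "i + int (m - 1) + 1 = i + int m"
        using m by (simp_all add: of_nat_diff)
      moreover have "word_act n ?w i = Option.bind (word_act n (wpow [Le, Lg] (m - 1)) i)
          (\<lambda>j. word_act n (wpow [Le, Lg] (m - 2) @ [Le]) (j + 1))"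
        unfolding word_act_append[of n "wpow [Le, Lg] (m - 1)"]
        by (rule arg_cong[where f = "Option.bind _"]) (simp add: fun_eq_iff)
      moreover have "(\<exists>j<m - 1. int n dvd i + int j) \<or> (\<exists>j<m - 1. int n dvd i + int m + int j) \<longleftrightarrow>
          \<not> int m dvd i - 1"
        using m by (intro no_hit_but_antipodes_iff n) simp
      ultimately show ?thesis
        by (cases "\<exists>j<m - 1. int n dvd i + int j") (auto simp: word_act_wpow_eg word_act_wpow_eg_e)
    qed
    have dvd: "int m dvd 1 - i \<longleftrightarrow> int m dvd i - 1" by (rule dvd_diff_commute)
    \<comment> \<open>The images of \<open>i\<close> and \<open>2 - i\<close> differ by twice a
      multiple of m, hence by a multiple of n.\<close>
    have shifted: "int n dvd 2 - 2 * i" if "int m dvd i - 1"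
    proof -
      have "2 * int m dvd 2 * (1 - i)" using that by (intro mult_dvd_mono) (simp_all add: dvd)
      then show ?thesis by (simp add: n)
    qed
    have none: "word_act n (wpow [Le, Lg] (n - 1) @ [Le]) i = None" for i
      using ex_dvd_add[of n i] m by (simp add: word_act_wpow_eg_e n)
    from 5 \<open>even n\<close> consider "u = [Lh, Lg] @ ?w" "v = ?w"
      | "u = [Lh] @ wpow [Le, Lg] (n - 1) @ [Le]" "v = wpow [Le, Lg] (n - 1) @ [Le]"
      by (auto simp: Q5_def n)
    then show ?thesis
    proof cases
      case 1
      have "word_act n u i = word_act n ?w (2 - i)" by (simp add: 1)
      then show ?thesis using dvd shifted by (simp only: 1(2) act) (simp split: if_splits)
    next
      case 2
      have "word_act n u i = word_act n v (1 - i)" by (simp add: 2)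
      then show ?thesis by (simp only: 2(2) none option.rel_inject)
    qed
  qed
qed

lemma word_congruence_word_map_kernel: "word_congruence {(u, v). word_map n u = word_map n v}"
  by (auto simp: word_congruence_def word_map_append intro!: equivI reflI symI transI)

lemma word_map_eq_iff_congruent:
  assumes "n \<ge> 3"
  shows "word_map n u = word_map n v \<longleftrightarrow> (u, v) \<in> gen_congruence (DPC_relations n)"
proof
  assume eq: "word_map n u = word_map n v"
  show "(u, v) \<in> gen_congruence (DPC_relations n)"
  proof (rule gen_congruence_complete)
    fix f :: "letter \<Rightarrow> letter list set endo"
    assume "\<And>p q. (p, q) \<in> DPC_relations n \<Longrightarrow> prod_list (map f p) = prod_list (map f q)"
    then interpret DPC_relations_model n f
      using assms by unfold_locales
    show "prod_list (map f u) = prod_list (map f v)"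
      using eq word_map_eq_iff[OF n_pos] by (intro word_act_determines_ev) blast
  qed
next
  have "DPC_relations n \<subseteq> {(u, v). word_map n u = word_map n v}"
    using word_act_relation[OF assms] word_map_eq_iff[of n] assms by auto
  with word_congruence_word_map_kernel
  have "gen_congruence (DPC_relations n) \<subseteq> {(u, v). word_map n u = word_map n v}"
    by (rule gen_congruence_least)
  moreover assume "(u, v) \<in> gen_congruence (DPC_relations n)"
  ultimately show "word_map n u = word_map n v" by blast
qed

section \<open>The monoid of partial isometries\<close>

lemma partial_isometries_comp:
  assumes "\<alpha> \<in> partial_isometries n" "\<beta> \<in> partial_isometries n"
  shows "\<beta> \<circ>\<^sub>m \<alpha> \<in> partial_isometries n"
proof -
  have *: "\<exists>y. \<alpha> x = Some y \<and> \<beta> y = Some z" if "(\<beta> \<circ>\<^sub>m \<alpha>) x = Some z" for x z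
    using that by (simp add: map_comp_Some_iff)
  have "dom (\<beta> \<circ>\<^sub>m \<alpha>) \<subseteq> {1..n}"
    using assms(1) * by (fastforce simp: partial_isometries_def)
  moreover have "ran (\<beta> \<circ>\<^sub>m \<alpha>) \<subseteq> {1..n}"
    using assms(2) * by (fastforce simp: partial_isometries_def ran_def)
  moreover have "cycle_dist n (the ((\<beta> \<circ>\<^sub>m \<alpha>) x)) (the ((\<beta> \<circ>\<^sub>m \<alpha>) y)) = cycle_dist n x y"
    if dom: "x \<in> dom (\<beta> \<circ>\<^sub>m \<alpha>)" "y \<in> dom (\<beta> \<circ>\<^sub>m \<alpha>)" for x y
  proof -
    from dom obtain x' x'' y' y'' where
      "\<alpha> x = Some x'" "\<beta> x' = Some x''" "\<alpha> y = Some y'" "\<beta> y' = Some y''"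
      using * by blast
    moreover from this have "cycle_dist n x' y' = cycle_dist n x y"
      using assms(1) by (force simp: partial_isometries_def)
    moreover from calculation have "cycle_dist n x'' y'' = cycle_dist n x' y'"
      using assms(2) by (force simp: partial_isometries_def)
    ultimately show ?thesis by simp
  qed
  ultimately show ?thesis by (simp add: partial_isometries_def)
qed

lemma id_in_partial_isometries: "A \<subseteq> {1..n} \<Longrightarrow> Some |` A \<in> partial_isometries n"
  by (auto simp: partial_isometries_def restrict_map_def ran_def split: if_splits)

lemma restrict_isometry_in_partial_isometries:
  assumes "\<And>x. x \<in> {1..n} \<Longrightarrow> \<phi> x \<in> {1..n}"
    and "\<And>x y. x \<in> {1..n} \<Longrightarrow> y \<in> {1..n} \<Longrightarrow> cycle_dist n (\<phi> x) (\<phi> y) = cycle_dist n x y"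
  shows "(\<lambda>x. Some (\<phi> x)) |` {1..n} \<in> partial_isometries n"
proof -
  have "dom ((\<lambda>x. Some (\<phi> x)) |` {1..n}) = {1..n}" by auto
  moreover have "ran ((\<lambda>x. Some (\<phi> x)) |` {1..n}) \<subseteq> {1..n}"
    using assms(1) by (force simp: ran_def restrict_map_def split: if_splits)
  ultimately show ?thesis using assms(2) by (simp add: partial_isometries_def)
qed

lemma letter_map_in_partial_isometries: "letter_map n b \<in> partial_isometries n"
proof (cases b)
  case Lg
  have "(\<lambda>i. Some (if i < n then i + 1 else 1)) |` {1..n} \<in> partial_isometries n"
  proof (rule restrict_isometry_in_partial_isometries)
    fix x y assume x: "x \<in> {1..n}" and y: "y \<in> {1..n}"
    \<comment> \<open>Wrapping around exchanges the two arcs, that is, the two arguments of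
      \<open>min\<close>.\<close>
    have "cycle_dist n (z + 1) 1 = cycle_dist n z n" "cycle_dist n 1 (z + 1) = cycle_dist n n z"
      if "z < n" for z
      using that by (simp_all add: cycle_dist_def min.commute)
    moreover have "cycle_dist n (x + 1) (y + 1) = cycle_dist n x y"
      "cycle_dist n 1 1 = cycle_dist n n n"
      by (simp_all add: cycle_dist_def)
    moreover have "x = n" if "\<not> x < n" using that x by simp
    moreover have "y = n" if "\<not> y < n" using that y by simp
    ultimately show "cycle_dist n (if x < n then x + 1 else 1) (if y < n then y + 1 else 1) =
        cycle_dist n x y"
      by (cases "x < n"; cases "y < n") simp_all
  qed auto
  moreover have "(\<lambda>i. Some (if i < n then i + 1 else 1)) =
      (\<lambda>i. if i < n then Some (i + 1) else Some 1)"
    by auto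
  ultimately show ?thesis by (simp add: Lg)
next
  case Lh
  have "(\<lambda>i. Some (n + 1 - i)) |` {1..n} \<in> partial_isometries n"
    by (rule restrict_isometry_in_partial_isometries)
      (auto simp: cycle_dist_def of_nat_diff abs_minus_commute)
  then show ?thesis by (simp add: Lh)
next
  case Le
  have "{1..n - 1} \<subseteq> {1..n}" by auto
  then show ?thesis by (simp add: Le id_in_partial_isometries)
qed

lemma word_map_in_partial_isometries: "word_map n w \<in> partial_isometries n"
  by (induction w)
    (simp_all add: id_in_partial_isometries letter_map_in_partial_isometries partial_isometries_comp
      del: letter_map.simps)

lemma monoid_DPC: "monoid (DPC n)"
proof (rule monoidI)
  fix \<alpha> assume "\<alpha> \<in> carrier (DPC n)"
  then have dom: "dom \<alpha> \<subseteq> {1..n}" and ran: "ran \<alpha> \<subseteq> {1..n}"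
    by (simp_all add: DPC_def partial_isometries_def)
  have "\<alpha> \<circ>\<^sub>m Some |` {1..n} = \<alpha>"
  proof
    fix x
    show "(\<alpha> \<circ>\<^sub>m Some |` {1..n}) x = \<alpha> x"
    proof (cases "x \<in> {1..n}")
      case False
      then have "\<alpha> x = None" using dom by blast
      then show ?thesis using False by (simp add: map_comp_def restrict_map_def)
    qed (simp add: map_comp_def)
  qed
  then show "\<one>\<^bsub>DPC n\<^esub> \<otimes>\<^bsub>DPC n\<^esub> \<alpha> = \<alpha>" by (simp add: DPC_def)
  have "Some |` {1..n} \<circ>\<^sub>m \<alpha> = \<alpha>"
  proof
    fix x
    show "(Some |` {1..n} \<circ>\<^sub>m \<alpha>) x = \<alpha> x"
      using ran by (cases "\<alpha> x") (auto simp: map_comp_def restrict_map_def ran_def)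
  qed
  then show "\<alpha> \<otimes>\<^bsub>DPC n\<^esub> \<one>\<^bsub>DPC n\<^esub> = \<alpha>" by (simp add: DPC_def)
next
  fix \<alpha> \<beta> \<gamma>
  show "(\<alpha> \<otimes>\<^bsub>DPC n\<^esub> \<beta>) \<otimes>\<^bsub>DPC n\<^esub> \<gamma> = \<alpha> \<otimes>\<^bsub>DPC n\<^esub> (\<beta> \<otimes>\<^bsub>DPC n\<^esub> \<gamma>)"
    by (auto simp: DPC_def map_comp_def fun_eq_iff split: option.split)
qed (simp_all add: DPC_def partial_isometries_comp id_in_partial_isometries)

section \<open>Generation by the letters\<close>

lemma cycle_dist_eqD:
  assumes "cycle_dist n a b = cycle_dist n x y"
  shows "int n dvd (int a - int b) - (int x - int y) \<or> int n dvd (int a - int b) + (int x - int y)"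
proof -
  define p q where "p = int a - int b" and "q = int x - int y"
  have "min \<bar>p\<bar> (int n - \<bar>p\<bar>) = min \<bar>q\<bar> (int n - \<bar>q\<bar>)"
    using assms by (simp add: cycle_dist_def p_def q_def)
  \<comment> \<open>Either |p| = |q| or |p| + |q| = n; the signs account for the remaining
    alternatives.\<close>
  then have "p - q \<in> {0, int n, - int n} \<or> p + q \<in> {0, int n, - int n}"
    by (auto simp: min_def abs_if split: if_splits)
  then show ?thesis unfolding p_def q_def by auto
qed

text \<open>Relative to a base point \<open>p\<close>, every point is mapped with sign \<open>1\<close> or \<open>- 1\<close>. Both signs cannot be
  needed: if \<open>y\<close> only admits \<open>- 1\<close> and \<open>z\<close> only admits \<open>1\<close>, the distance of \<open>y\<close> and \<open>z\<close> changes.\<close>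

lemma partial_isometry_dihedral:
  assumes "\<alpha> \<in> partial_isometries n"
  obtains s k where "s = 1 \<or> s = - 1"
    "\<And>x. x \<in> dom \<alpha> \<Longrightarrow> int n dvd int (the (\<alpha> x)) - (s * int x + k)"
proof (cases "dom \<alpha> = {}")
  case True
  then show ?thesis using that[of 1] by simp
next
  case False
  then obtain p where p: "p \<in> dom \<alpha>" by blast
  define a where "a x = int (the (\<alpha> x)) - int (the (\<alpha> p))" for x
  define c where "c x = int x - int p" for x
  have dist: "int n dvd (a x - a y) - (c x - c y) \<or> int n dvd (a x - a y) + (c x - c y)"
    if "x \<in> dom \<alpha>" "y \<in> dom \<alpha>" for x y
    using that assms cycle_dist_eqD[of n "the (\<alpha> x)" "the (\<alpha> y)" x y]
    by (simp add: a_def c_def partial_isometries_def)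
  have base: "int n dvd a x - c x \<or> int n dvd a x + c x" if "x \<in> dom \<alpha>" for x
    using dist[OF that p] by (simp add: a_def c_def)
  have "(\<forall>x\<in>dom \<alpha>. int n dvd a x - c x) \<or> (\<forall>x\<in>dom \<alpha>. int n dvd a x + c x)"
  proof (rule ccontr)
    assume "\<not> ?thesis"
    then obtain y z where y: "y \<in> dom \<alpha>" "\<not> int n dvd a y - c y"
      and z: "z \<in> dom \<alpha>" "\<not> int n dvd a z + c z" by blast
    have y': "int n dvd a y + c y" and z': "int n dvd a z - c z" using base y z by blast+
    from dist[OF z(1) y(1)] show False
    proof
      assume "int n dvd (a z - a y) - (c z - c y)"
      then have "int n dvd (a z - c z) - ((a z - a y) - (c z - c y))" using z' by (rule dvd_diff[rotated])
      then show False using y(2) by simp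
    next
      assume "int n dvd (a z - a y) + (c z - c y)"
      then have "int n dvd ((a z - a y) + (c z - c y)) + (a y + c y)" using y' by (rule dvd_add)
      then show False using z(2) by simp
    qed
  qed
  then show ?thesis
  proof
    assume *: "\<forall>x\<in>dom \<alpha>. int n dvd a x - c x"
    show ?thesis
      by (rule that[of 1 "int (the (\<alpha> p)) - int p"])
        (use * in \<open>auto simp: a_def c_def algebra_simps\<close>)
  next
    assume *: "\<forall>x\<in>dom \<alpha>. int n dvd a x + c x"
    show ?thesis
      by (rule that[of "- 1" "int (the (\<alpha> p)) + int p"])
        (use * in \<open>auto simp: a_def c_def algebra_simps\<close>)
  qed
qed

lemma word_of_normal_form:
  assumes "n > 0" "s = 1 \<or> s = - 1"
  obtains w where "\<And>i. map_option (vertex n) (word_act n w i) =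
    (if meets n xs (s * i + k) then None else Some (vertex n (s * i + k)))"
proof -
  \<comment> \<open>Rotation by \<open>p x\<close> brings \<open>x\<close> to a multiple of n, where
    \<open>e\<close> deletes it.\<close>
  define p where "p x = nat ((- x) mod int n)" for x
  have p: "p x \<le> n" "int (p x) = (- x) mod int n" for x
    using assms(1) by (simp_all add: p_def nat_le_iff less_imp_le)
  define idem where "idem x = wpow [Lg] (p x) @ [Le] @ wpow [Lg] (n - p x)" for x
  have idem: "word_act n (idem x) i = (if int n dvd i - x then None else Some (i + int n))" for x i
  proof -
    have "int n dvd i + int (p x) \<longleftrightarrow> int n dvd i - x"
      unfolding p(2) by (simp add: dvd_eq_mod_eq_0 mod_simps)
    then show ?thesis
      using p(1)[of x] by (simp add: idem_def word_act_append word_act_wpow_g of_nat_diff)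
  qed
  \<comment> \<open>Each factor makes a full turn, so the lifted value drifts by n per entry;
    \<open>vertex\<close> removes the drift.\<close>
  have idems: "word_act n (concat (map idem xs)) i =
      (if meets n xs i then None else Some (i + int n * int (length xs)))" for i
  proof (induction xs arbitrary: i)
    case (Cons x xs)
    have "meets n xs (i + int n) \<longleftrightarrow> meets n xs i" by (rule meets_cong) simp
    then show ?case
      by (auto simp: Cons word_act_append idem meets_def algebra_simps)
  qed (simp add: meets_def)
  define base where "base =
    (if s = 1 then wpow [Lg] (nat (k mod int n)) else Lh # wpow [Lg] (nat ((k - 1) mod int n)))"
  have "\<exists>j. word_act n base i = Some j \<and> int n dvd j - (s * i + k)" for i
  proof -
    have "int n dvd k mod int n - k" for k
      by (simp add: mod_eq_dvd_iff[symmetric])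
    note this[of k] this[of "k - 1"]
    moreover have "word_act n base i =
        Some (if s = 1 then i + k mod int n else 1 - i + (k - 1) mod int n)"
      using assms(1) by (simp add: base_def word_act_wpow_g)
    ultimately show ?thesis
      using assms(2) by (auto simp: algebra_simps)
  qed
  then have "map_option (vertex n) (word_act n (base @ concat (map idem xs)) i) =
    (if meets n xs (s * i + k) then None else Some (vertex n (s * i + k)))" for i
  proof -
    obtain j where j: "word_act n base i = Some j" "int n dvd j - (s * i + k)"
      using \<open>\<And>i. \<exists>j. _ i j\<close> by blast
    have "meets n xs j \<longleftrightarrow> meets n xs (s * i + k)" using j(2) by (rule meets_cong)
    moreover have "vertex n (j + int n * int (length xs)) = vertex n (s * i + k)"
      using assms(1) dvd_add[OF j(2) dvd_triv_left[of "int n" "int (length xs)"]]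
      by (simp add: vertex_eq_iff algebra_simps)
    ultimately show ?thesis by (simp add: word_act_append j(1) idems)
  qed
  then show ?thesis by (rule that)
qed

lemma range_word_map:
  assumes "n > 0"
  shows "range (word_map n) = partial_isometries n"
proof
  show "range (word_map n) \<subseteq> partial_isometries n"
    using word_map_in_partial_isometries by blast
  show "partial_isometries n \<subseteq> range (word_map n)"
  proof
    fix \<alpha> assume \<alpha>: "\<alpha> \<in> partial_isometries n"
    then have dom: "dom \<alpha> \<subseteq> {1..n}" and ran: "ran \<alpha> \<subseteq> {1..n}"
      by (simp_all add: partial_isometries_def)
    from \<alpha> obtain s k where s: "s = 1 \<or> s = - 1"
      and sk: "\<And>x. x \<in> dom \<alpha> \<Longrightarrow> int n dvd int (the (\<alpha> x)) - (s * int x + k)"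
      by (rule partial_isometry_dihedral) blast
    \<comment> \<open>Deletion follows the dihedral map, so the points outside the domain enter
      through their images.\<close>
    define xs where "xs = map (\<lambda>x. s * int x + k) (sorted_list_of_set ({1..n} - dom \<alpha>))"
    obtain w where w: "\<And>i. map_option (vertex n) (word_act n w i) =
        (if meets n xs (s * i + k) then None else Some (vertex n (s * i + k)))"
      using word_of_normal_form[OF assms s] by blast
    have meets_iff: "meets n xs (s * int x + k) \<longleftrightarrow> x \<notin> dom \<alpha>" if "x \<in> {1..n}" for x
    proof -
      have "int n dvd (s * int x + k) - (s * int y + k) \<longleftrightarrow> x = y" if "y \<in> {1..n}" for y
      proof -
        have "int n dvd (s * int x + k) - (s * int y + k) \<longleftrightarrow> int n dvd int x - int y"
          using s dvd_diff_commute[of "int n" "int x" "int y"] by auto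
        also have "\<dots> \<longleftrightarrow> x = y"
          using vertex_eq_iff[OF assms, of "int x" "int y"] vertex_int that \<open>x \<in> {1..n}\<close> by metis
        finally show ?thesis .
      qed
      then show ?thesis using that by (auto simp: meets_def xs_def)
    qed
    have "word_map n w x = \<alpha> x" for x
    proof (cases "x \<in> {1..n}")
      case True
      have "word_map n w x = map_option (vertex n) (word_act n w (int x))"
        using word_map_vertex[OF assms, of w "int x"] vertex_int[OF True] by simp
      also have "\<dots> = (if x \<notin> dom \<alpha> then None else Some (vertex n (s * int x + k)))"
        by (simp only: w meets_iff[OF True])
      also have "\<dots> = \<alpha> x"
      proof (cases "\<alpha> x")
        case (Some y)
        then have "y \<in> {1..n}" using ran by (auto simp: ran_def)
        then have "vertex n (s * int x + k) = y"
          using sk[of x] Some by (intro vertex_eqI) auto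
        then show ?thesis using Some by auto
      qed auto
      finally show ?thesis .
    next
      case False
      then show ?thesis using dom word_map_outside[OF False] by (metis domIff subsetD)
    qed
    then show "\<alpha> \<in> range (word_map n)" by (metis ext rangeI)
  qed
qed

theorem theorem2p8:
  fixes n :: nat
  assumes "n \<ge> 3"
  shows "defined_by_presentation (DPC n) (letter_map n) (DPC_relations n)"
proof (rule defined_by_presentationI[where ev = "word_map n"])
  show "monoid (DPC n)" by (rule monoid_DPC)
  show "range (word_map n) = carrier (DPC n)"
    using assms by (simp add: range_word_map DPC_def)
  show "word_map n (u @ v) = word_map n u \<otimes>\<^bsub>DPC n\<^esub> word_map n v" for u v
    by (simp add: DPC_def word_map_append)
  show "word_map n u = word_map n v \<longleftrightarrow> (u, v) \<in> gen_congruence (DPC_relations n)" for u v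
    by (rule word_map_eq_iff_congruent[OF assms])
  show "word_map n [b] = letter_map n b" for b
  proof -
    have "Some |` {1..n} \<circ>\<^sub>m letter_map n b = letter_map n b"
      using monoid.r_one[OF monoid_DPC, of "letter_map n b" n] letter_map_in_partial_isometries
      by (simp add: DPC_def)
    then show ?thesis by simp
  qed
qed

end
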